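(* Let $Y$ be a real random variable with a symmetric (about $0$) distribution $G$ having density $g$ and finite moments of all positive orders. If $$K[g]=\int_{-\infty}^{\infty}\frac{-\log g(x)}{1+x^2}\,dx<\infty,$$ then there exists a symmetric distribution $G_*\neq G$ on $\mathbb{R}$ having the same moment sequence as $G$.
   Context: Distributions are Borel probability distributions on $\mathbb{R}=(-\infty,\infty)$, and densities are with respect to Lebesgue measure. "Finite moments of all positive orders" means $\mathbf{E}[|Y|^k]<\infty$ for all $k=1,2,\ldots$. The moment sequence of the distribution of $Y$ is $\{\mathbf{E}[Y^k]\}_{k=1}^{\infty}$. A distribution is symmetric if it is that of a random variable $Y$ such that $Y$ and $-Y$ have the same distribution. The integrand is taken to be $+\infty$ where $g(x)=0$. *)

theory Defs
  imports "HOL-Probability.Probability"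
begin

text \<open>A distribution \<open>G\<close> is the law of the identity random variable on the probability
  space \<open>G\<close>. The next lemma gives the corresponding statement for an arbitrary random variable.\<close>

definition symmetric_distribution :: "real measure \<Rightarrow> bool" where
  "symmetric_distribution G \<longleftrightarrow> distr G borel (\<lambda>x. - x) = G"

lemma symmetric_distribution_distr_iff:
  assumes "Y \<in> borel_measurable M"
  shows "symmetric_distribution (distr M borel Y) \<longleftrightarrow>
    distr M borel (\<lambda>\<omega>. - Y \<omega>) = distr M borel Y"
  using assms by (simp add: symmetric_distribution_def distr_distr comp_def)

definition finite_moments :: "'a measure \<Rightarrow> ('a \<Rightarrow> real) \<Rightarrow> bool" where
  "finite_moments M Y \<longleftrightarrow> (\<forall>k::nat. k \<ge> 1 \<longrightarrow> integrable M (\<lambda>\<omega>. \<bar>Y \<omega>\<bar> ^ k))"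

definition moment :: "'a measure \<Rightarrow> ('a \<Rightarrow> real) \<Rightarrow> nat \<Rightarrow> real" where
  "moment M Y k = (\<integral>\<omega>. Y \<omega> ^ k \<partial>M)"

definition krein_integrand :: "(real \<Rightarrow> real) \<Rightarrow> real \<Rightarrow> ereal" where
  "krein_integrand g x = (if g x = 0 then \<infinity> else ereal (- ln (g x) / (1 + x\<^sup>2)))"

text \<open>The Lebesgue integral of an extended real function, as the integral of its positive part
  minus the integral of its negative part; \<open>e2ennreal\<close> maps negative numbers to \<open>0\<close>.
  For a probability density \<open>g\<close> the second integral is at most \<open>1\<close>, because
  \<open>ln y \<le> y\<close> for \<open>y > 0\<close>, so that \<open>\<infinity> - \<infinity>\<close> does not occur and the value is
  a real number or \<open>\<infinity>\<close>.\<close>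

definition krein_integral :: "(real \<Rightarrow> real) \<Rightarrow> ereal" where
  "krein_integral g =
    enn2ereal (\<integral>\<^sup>+ x. e2ennreal (krein_integrand g x) \<partial>lborel) -
    enn2ereal (\<integral>\<^sup>+ x. e2ennreal (- krein_integrand g x) \<partial>lborel)"

end

theory Submission
  imports Defs "HOL-Complex_Analysis.Cauchy_Integral_Formula"
begin

text \<open>
  The distribution \<open>G\<close> is changed by adding to its density \<open>g\<close> a function \<open>h\<close> that is even,
  bounded by \<open>g\<close> (after \<open>g\<close> has been made even), orthogonal to all powers of \<open>x\<close>, and not zero
  almost everywhere. The function \<open>h\<close> is the even part of \<open>Re F\<close>, where \<open>F\<close> is the boundary function
  on the real line of a bounded analytic function on the upper half-plane with \<open>\<bar>F\<bar> \<le> g\<close>. Orthogonality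
  holds because \<open>F x * x ^ j\<close> is again the boundary function of an analytic function, and it is
  integrable; so its integral over the line is \<open>0\<close> (lemma \<open>moments_vanish\<close>).

  An analytic function whose boundary values are bounded by \<open>g\<close> and which is not identically zero
  exists exactly when \<open>ln g\<close> is not too negative, and this is what the Krein integral measures. The upper
  half-plane is mapped to the unit disc by the Cayley transform, which takes \<open>\<i>\<close> to \<open>0\<close> and
  the Cauchy distribution, with density \<open>1 / (pi (1 + x\<^sup>2))\<close>, to the uniform distribution on the
  circle. A harmonic function \<open>u\<close> with boundary values below \<open>ln g\<close> is the real part of an analytic
  function, whose exponential has boundary values of modulus at most \<open>g\<close> and has the value
  \<open>exp (u 0)\<close> at the origin, up to a unimodular factor. Here \<open>u 0\<close> is the Cauchy mean of the
  boundary values of \<open>u\<close>, which is finite when the Krein integral is.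

  The exponential is constructed without conjugate functions and without a theory of boundary values.
  One takes entire functions \<open>P n\<close> whose real parts on the circle decrease to a function below
  \<open>ln g\<close>, and shows that the functions \<open>exp (P n)\<close> converge in the mean on the circle. The reason is
  an elementary computation with the mean value property of their ratios (lemma
  \<open>outer_function_limit\<close>). That suitable \<open>P n\<close> exist follows from the outer
  regularity of the Cauchy distribution and the Stone-Weierstrass theorem (lemma
  \<open>outer_function_minorant\<close>). The two distributions differ because the integral of \<open>h\<close> against
  \<open>1 / (1 + x\<^sup>2)\<close> is \<open>pi\<close> times the positive value of the analytic function at the origin.
\<close>

section \<open>The Cayley transform and the mean value property\<close>

definition cayley :: "real \<Rightarrow> complex" where
  "cayley x = (1 + \<i> * of_real x) / (1 - \<i> * of_real x)"

definition cauchy_law :: "real measure" where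
  "cauchy_law = density lborel (\<lambda>x. ennreal (1 / (pi * (1 + x\<^sup>2))))"

lemma one_minus_ii_neq_0 [simp]: "1 - \<i> * complex_of_real x \<noteq> 0"
  by (auto simp: complex_eq_iff)

lemma norm_cayley [simp]: "norm (cayley x) = 1"
proof -
  have "norm (1 + \<i> * complex_of_real x) = norm (1 - \<i> * complex_of_real x)"
    by (simp add: cmod_def)
  then show ?thesis
    by (simp add: cayley_def norm_divide)
qed

lemma cayley_neq_0 [simp]: "cayley x \<noteq> 0"
  using norm_cayley[of x] by (metis norm_zero zero_neq_one)

lemma one_plus_cayley: "1 + cayley x = 2 / (1 - \<i> * of_real x)"
  by (simp add: cayley_def field_simps)

lemma cayley_neq_minus_1 [simp]: "cayley x \<noteq> -1" "1 + cayley x \<noteq> 0"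
proof -
  show "1 + cayley x \<noteq> 0"
    unfolding one_plus_cayley by simp
  then show "cayley x \<noteq> -1"
    by (metis add.right_inverse)
qed

text \<open>The next identities express \<open>x\<close> and \<open>1 + x\<^sup>2\<close> as rational functions of the point
  \<open>cayley x\<close> of the unit circle. Their only pole, at \<open>-1\<close>, is the image of infinity.\<close>

lemma inverse_cayley: "\<i> * (1 - cayley x) / (1 + cayley x) = of_real x"
  unfolding one_plus_cayley by (simp add: cayley_def field_simps)

lemma one_plus_square_eq: "(1 - \<i> * of_real x) * (1 + \<i> * of_real x) = complex_of_real (1 + x\<^sup>2)"
  by (simp add: algebra_simps power2_eq_square)

lemma one_plus_square_cayley: "4 * cayley x / (1 + cayley x)\<^sup>2 = of_real (1 + x\<^sup>2)"
  unfolding one_plus_cayley one_plus_square_eq[symmetric]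
  by (simp add: cayley_def field_simps power2_eq_square)

lemma continuous_cayley [continuous_intros]: "continuous_on A cayley"
  unfolding cayley_def by (intro continuous_intros) auto

lemma measurable_cayley [measurable]: "cayley \<in> borel_measurable borel"
  by (intro borel_measurable_continuous_onI continuous_cayley)

lemma sets_cauchy_law [simp, measurable_cong]: "sets cauchy_law = sets borel"
  by (simp add: cauchy_law_def)

lemma space_cauchy_law [simp]: "space cauchy_law = UNIV"
  by (simp add: cauchy_law_def)

lemma cayley_has_vector_derivative:
  "(cayley has_vector_derivative (2 * \<i> * cayley x / of_real (1 + x\<^sup>2))) (at x)"
proof -
  have "((\<lambda>z. (1 + \<i> * z) / (1 - \<i> * z)) has_field_derivative
      2 * \<i> / (1 - \<i> * of_real x)\<^sup>2) (at (complex_of_real x))"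
    by (auto intro!: derivative_eq_intros simp: field_simps power2_eq_square)
  moreover have "2 * \<i> / (1 - \<i> * of_real x)\<^sup>2 = 2 * \<i> * cayley x / of_real (1 + x\<^sup>2)"
  proof -
    have "1 + \<i> * complex_of_real x \<noteq> 0"
      by (auto simp: complex_eq_iff)
    moreover have "2 * \<i> / a\<^sup>2 = 2 * \<i> * (b / a) / (a * b)" if "b \<noteq> 0" for a b :: complex
      using that by (simp add: power2_eq_square)
    ultimately show ?thesis
      unfolding one_plus_square_eq[symmetric] cayley_def by blast
  qed
  ultimately show ?thesis
    using has_vector_derivative_real_field[of "\<lambda>z. (1 + \<i> * z) / (1 - \<i> * z)" _ x UNIV]
    by (simp add: cayley_def[abs_def])
qed

lemma tendsto_cayley_at_infinity: "(cayley \<longlongrightarrow> -1) at_infinity"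
proof -
  have "((\<lambda>x. 2 / (1 - \<i> * complex_of_real x)) \<longlongrightarrow> 0) at_infinity"
  proof (rule tendsto_divide_0[OF tendsto_const])
    have "filterlim complex_of_real at_infinity at_infinity"
      by (rule filterlim_norm_at_top_imp_at_infinity)
        (use filterlim_norm_at_top[where 'a = real] in \<open>simp add: real_norm_def[abs_def]\<close>)
    then     have "filterlim (\<lambda>x. 1 + - \<i> * complex_of_real x) at_infinity at_infinity"
      by (intro tendsto_add_filterlim_at_infinity tendsto_const
            tendsto_mult_filterlim_at_infinity[OF tendsto_const]) auto
    then show "filterlim (\<lambda>x. 1 - \<i> * complex_of_real x) at_infinity at_infinity"
      by simp
  qed
  then have "((\<lambda>x. 1 + cayley x - 1) \<longlongrightarrow> 0 - 1) at_infinity"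
    unfolding one_plus_cayley by (intro tendsto_intros)
  then show ?thesis
    by simp
qed

lemma integrable_one_plus_square: "integrable lborel (\<lambda>x::real. 1 / (1 + x\<^sup>2))"
  using integrable_inverse_1_plus_square by (simp add: set_integrable_def inverse_eq_divide)

lemma integral_one_plus_square: "(\<integral>x. 1 / (1 + x\<^sup>2) \<partial>lborel) = pi"
  using LBINT_inverse_1_plus_square
  by (simp add: interval_lebesgue_integral_def set_lebesgue_integral_def inverse_eq_divide)

lemma integrable_cauchy_law:
  fixes f :: "real \<Rightarrow> 'b::{banach, second_countable_topology}"
  assumes "f \<in> borel_measurable borel"
  shows "integrable cauchy_law f \<longleftrightarrow> integrable lborel (\<lambda>x. (1 / (pi * (1 + x\<^sup>2))) *\<^sub>R f x)"
  unfolding cauchy_law_def using assms by (subst integrable_density) auto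

lemma integral_cauchy_law:
  fixes f :: "real \<Rightarrow> 'b::{banach, second_countable_topology}"
  assumes "f \<in> borel_measurable borel"
  shows "integral\<^sup>L cauchy_law f = (\<integral>x. (1 / (pi * (1 + x\<^sup>2))) *\<^sub>R f x \<partial>lborel)"
  unfolding cauchy_law_def using assms by (subst integral_density) auto

lemma prob_space_cauchy_law: "prob_space cauchy_law"
proof
  have "integrable lborel (\<lambda>x::real. 1 / pi * (1 / (1 + x\<^sup>2)))"
    using integrable_one_plus_square by (rule integrable_mult_right)
  moreover have "(\<integral>x. 1 / pi * (1 / (1 + x\<^sup>2)) \<partial>lborel) = 1"
    by (subst integral_mult_right_zero) (simp add: integral_one_plus_square)
  ultimately have "(\<integral>\<^sup>+ x. ennreal (1 / pi * (1 / (1 + x\<^sup>2))) \<partial>lborel) = 1"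
    by (subst nn_integral_eq_integral) auto
  then show "emeasure cauchy_law (space cauchy_law) = 1"
    by (simp add: cauchy_law_def emeasure_density)
qed

interpretation cauchy_law: prob_space cauchy_law
  by (rule prob_space_cauchy_law)

text \<open>The mean value property on the unit circle, in the coordinate of the real line. Since
  \<open>(f z - f 0) / z\<close> extends holomorphically to \<open>0\<close>, it has a primitive \<open>H\<close> on the ball, and the
  derivative of \<open>H (cayley x)\<close> is \<open>2 \<i> (f (cayley x) - f 0) / (1 + x\<^sup>2)\<close>. The integral over the
  line of this derivative is \<open>0\<close>, because \<open>cayley x\<close> tends to \<open>-1\<close> at both ends.\<close>

lemma integral_holomorphic_cayley:
  assumes holf: "f holomorphic_on ball 0 R" and R: "R > 1"
  shows "integrable cauchy_law (\<lambda>x. f (cayley x))"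
    and "(\<integral>x. f (cayley x) \<partial>cauchy_law) = f 0"
proof -
  let ?B = "ball (0::complex) R"
  have w: "cayley x \<in> ?B" for x
    using R by simp
  have contf: "continuous_on ?B f"
    by (rule holomorphic_on_imp_continuous_on[OF holf])
  have cont_fw: "continuous_on UNIV (\<lambda>x. f (cayley x))"
    by (rule continuous_on_compose2[OF contf continuous_cayley]) (use w in auto)
  then have [measurable]: "(\<lambda>x. f (cayley x)) \<in> borel_measurable borel"
    by (rule borel_measurable_continuous_onI)
  have "compact (f ` sphere 0 1)"
    by (intro compact_continuous_image continuous_on_subset[OF contf]) (use R in auto)
  then obtain C where C: "\<And>z. norm z = 1 \<Longrightarrow> norm (f z) \<le> C"
    by (force dest!: compact_imp_bounded simp: bounded_iff)
  show int: "integrable cauchy_law (\<lambda>x. f (cayley x))"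
    by (rule cauchy_law.integrable_const_bound[where B = C]) (auto intro!: AE_I2 C)
  obtain h where h: "h holomorphic_on ?B" "\<And>z. z \<noteq> 0 \<Longrightarrow> h z = (f z - f 0) / z"
    using pole_lemma_open[OF holf, of 0] by fastforce
  obtain H where H: "\<And>z. z \<in> ?B \<Longrightarrow> (H has_field_derivative h z) (at z)"
    using holomorphic_convex_primitive'[OF convex_ball open_ball h(1)]
    by (metis at_within_open open_ball)
  define G where "G x = H (cayley x) / (2 * \<i> * pi)" for x
  define k where "k x = (1 / (pi * (1 + x\<^sup>2))) *\<^sub>R (f (cayley x) - f 0)" for x
  have G: "(G has_vector_derivative k x) (at x)" for x
  proof -
    have "((\<lambda>x. H (cayley x)) has_vector_derivative
        (2 * \<i> * cayley x / of_real (1 + x\<^sup>2)) * h (cayley x)) (at x)"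
      using field_vector_diff_chain_at[OF cayley_has_vector_derivative H[OF w]]
      by (simp add: o_def)
    then have "(G has_vector_derivative
        (2 * \<i> * cayley x / of_real (1 + x\<^sup>2)) * h (cayley x) / (2 * \<i> * pi)) (at x)"
      unfolding G_def by (rule has_vector_derivative_divide)
    moreover have "(2 * \<i> * cayley x / of_real (1 + x\<^sup>2)) * h (cayley x) / (2 * \<i> * pi) = k x"
    proof -
      have "(2 * \<i> * w / s) * (d / w) / (2 * \<i> * p) = d / (p * s)" if "w \<noteq> 0" for w s d p :: complex
        using that by simp
      then show ?thesis
        unfolding k_def h(2)[OF cayley_neq_0] by (simp add: scaleR_conv_of_real)
    qed
    ultimately show ?thesis
      by metis
  qed
  have pos: "1 + x\<^sup>2 \<noteq> 0" for x :: real
    by (smt (verit) zero_le_power2)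
  have cont_k: "continuous_on UNIV k"
    unfolding k_def using cont_fw by (intro continuous_intros) (auto simp: pos)
  have int_k: "integrable lborel k"
    unfolding k_def by (subst integrable_cauchy_law[symmetric]) (auto intro: int)
  have "isCont H (-1)"
    by (rule DERIV_isCont[OF H]) (use R in auto)
  then have "((\<lambda>x. H (cayley x)) \<longlongrightarrow> H (-1)) at_infinity"
    by (rule isCont_tendsto_compose[OF _ tendsto_cayley_at_infinity])
  then have limG: "(G \<longlongrightarrow> H (-1) / (2 * \<i> * pi)) at_infinity"
    unfolding G_def by (intro tendsto_intros) auto
  have "(LBINT x=-\<infinity>..\<infinity>. k x) = H (-1) / (2 * \<i> * pi) - H (-1) / (2 * \<i> * pi)"
  proof (rule interval_integral_FTC_integrable[where F = G])
    show "((G \<circ> real_of_ereal) \<longlongrightarrow> H (-1) / (2 * \<i> * pi)) (at_right (- \<infinity>))"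
      unfolding ereal_tendsto_simps using limG at_bot_le_at_infinity by (rule tendsto_mono[rotated])
    show "((G \<circ> real_of_ereal) \<longlongrightarrow> H (-1) / (2 * \<i> * pi)) (at_left \<infinity>)"
      unfolding ereal_tendsto_simps using limG at_top_le_at_infinity by (rule tendsto_mono[rotated])
    show "set_integrable lborel (einterval (- \<infinity>) \<infinity>) k"
      using int_k by (simp add: set_integrable_def)
    show "isCont k x" for x
      using cont_k by (simp add: continuous_on_eq_continuous_at)
  qed (use G in auto)
  then have "(\<integral>x. k x \<partial>lborel) = 0"
    by (simp add: interval_lebesgue_integral_def set_lebesgue_integral_def)
  then have "(\<integral>x. f (cayley x) - f 0 \<partial>cauchy_law) = 0"
    by (subst integral_cauchy_law) (auto simp: k_def)
  then show "(\<integral>x. f (cayley x) \<partial>cauchy_law) = f 0"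
    using int cauchy_law.prob_space by simp
qed

section \<open>Approximation by real parts of entire functions\<close>

text \<open>On the unit circle \<open>cnj z = 1 / z\<close>, so that real polynomials in the two coordinates are
  Laurent polynomials.\<close>

lemma real_polynomial_function_on_circle:
  fixes p :: "complex \<Rightarrow> real"
  assumes "real_polynomial_function p"
  shows "\<exists>N A. \<forall>z. norm z = 1 \<longrightarrow> of_real (p z) * z ^ N = poly A z"
  using assms
proof induction
  case (linear f)
  interpret bounded_linear f by fact
  define c where "c = Complex (f 1) (- f \<i>)"
  have "of_real (f z) * z = poly [:cnj c / 2, 0, c / 2:] z" if "norm z = 1" for z
  proof -
    have "z = Re z *\<^sub>R 1 + Im z *\<^sub>R \<i>"
      by (simp add: complex_eq_iff)
    then have "f z = Re z * f 1 + Im z * f \<i>"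
      by (metis add scaleR real_scaleR_def)
    then have "f z = Re (c * z)"
      by (simp add: c_def algebra_simps)
    then have "2 * of_real (f z) = c * z + cnj (c * z)"
      by (simp only: complex_add_cnj) simp
    then have "2 * of_real (f z) * z = c * z * z + cnj c * (z * cnj z)"
      by (simp add: algebra_simps)
    also have "z * cnj z = 1"
      using that by (simp add: complex_norm_square[symmetric])
    finally show ?thesis
      by (simp add: field_simps)
  qed
  then show ?case
    by (metis power_one_right)
next
  case (const c)
  then show ?case
    by (intro exI[of _ 0] exI[of _ "[:of_real c:]"]) auto
next
  case (add f g)
  then obtain M N A B where "\<And>z. norm z = 1 \<Longrightarrow> of_real (f z) * z ^ M = poly A z"
    "\<And>z. norm z = 1 \<Longrightarrow> of_real (g z) * z ^ N = poly B z"
    by metis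
  then have "of_real (f z + g z) * z ^ (M + N) = poly (A * monom 1 N + B * monom 1 M) z"
    if "norm z = 1" for z
    using that by (simp add: poly_monom power_add algebra_simps flip: \<open>\<And>z. norm z = 1 \<Longrightarrow> of_real (f z) * z ^ M = poly A z\<close>)
  then show ?case
    by blast
next
  case (mult f g)
  then obtain M N A B where "\<And>z. norm z = 1 \<Longrightarrow> of_real (f z) * z ^ M = poly A z"
    "\<And>z. norm z = 1 \<Longrightarrow> of_real (g z) * z ^ N = poly B z"
    by metis
  then have "of_real (f z * g z) * z ^ (M + N) = poly (A * B) z"
    if "norm z = 1" for z
    using that by (simp add: power_add algebra_simps flip: \<open>\<And>z. norm z = 1 \<Longrightarrow> of_real (f z) * z ^ M = poly A z\<close>)
  then show ?case
    by blast
qed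

text \<open>By the Stone-Weierstrass theorem and the preceding lemma, \<open>\<psi>\<close> is uniformly close to a
  real-valued Laurent polynomial. On the circle, replacing a term with a negative power of \<open>z\<close> by its
  complex conjugate does not change its real part and makes the power positive.\<close>

lemma circle_approx_Re_entire:
  fixes \<psi> :: "complex \<Rightarrow> real"
  assumes "continuous_on (sphere 0 1) \<psi>" and "e > 0"
  obtains P where "P holomorphic_on UNIV" "Im (P 0) = 0"
    "\<And>z. norm z = 1 \<Longrightarrow> \<bar>\<psi> z - Re (P z)\<bar> < e"
proof -
  obtain p where p: "real_polynomial_function p" "\<And>z. z \<in> sphere 0 1 \<Longrightarrow> \<bar>\<psi> z - p z\<bar> < e"
    using Stone_Weierstrass_real_polynomial_function[OF compact_sphere assms] by blast
  obtain N A where A: "\<And>z. norm z = 1 \<Longrightarrow> of_real (p z) * z ^ N = poly A z"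
    using real_polynomial_function_on_circle[OF p(1)] by blast
  define Q where "Q z = (\<Sum>i\<le>degree A. if N \<le> i then coeff A i * z ^ (i - N)
      else cnj (coeff A i) * z ^ (N - i))" for z
  \<comment> \<open>An imaginary constant may be subtracted freely; it makes the value at the origin real.\<close>
  define P where "P z = Q z - \<i> * Im (Q 0)" for z
  have "Re (P z) = p z" if z: "norm z = 1" for z
  proof -
    have z0: "z \<noteq> 0" and cz: "cnj z = 1 / z"
      using z by (auto simp: complex_norm_square divide_conv_cnj)
    have "of_real (p z) = poly A z / z ^ N"
      using A[OF z] z0 by (simp add: field_simps)
    also have "\<dots> = (\<Sum>i\<le>degree A. coeff A i * z ^ i / z ^ N)"
      by (simp add: poly_altdef sum_divide_distrib)
    finally have "p z = (\<Sum>i\<le>degree A. Re (coeff A i * z ^ i / z ^ N))"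
      by (metis Re_complex_of_real Re_sum)
    also have "\<dots> = (\<Sum>i\<le>degree A. Re (if N \<le> i then coeff A i * z ^ (i - N)
        else cnj (coeff A i) * z ^ (N - i)))"
    proof (intro sum.cong refl)
      fix i
      show "Re (coeff A i * z ^ i / z ^ N) = Re (if N \<le> i then coeff A i * z ^ (i - N)
        else cnj (coeff A i) * z ^ (N - i))"
      proof (cases "N \<le> i")
        case True
        then show ?thesis
          using z0 by (simp add: power_diff)
      next
        case False
        have "z ^ i / z ^ N = cnj (z ^ (N - i))"
          using False z0 by (simp add: power_diff cz power_divide field_simps)
        then have "coeff A i * z ^ i / z ^ N = cnj (cnj (coeff A i) * z ^ (N - i))"
          by (metis complex_cnj_cnj complex_cnj_mult times_divide_eq_right)
        then show ?thesis
          using False by (metis cnj.sel(1))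
      qed
    qed
    also have "\<dots> = Re (P z)"
      by (simp add: P_def Q_def Re_sum)
    finally show ?thesis ..
  qed
  moreover have "P holomorphic_on UNIV"
  proof -
    have "(\<lambda>z. if N \<le> i then coeff A i * z ^ (i - N) else cnj (coeff A i) * z ^ (N - i))
        holomorphic_on UNIV" for i
      by (cases "N \<le> i") (auto intro!: holomorphic_intros)
    then show ?thesis
      unfolding P_def Q_def by (intro holomorphic_intros)
  qed
  moreover have "Im (P 0) = 0"
    by (simp add: P_def)
  ultimately show ?thesis
    using p(2) by (intro that) auto
qed

text \<open>Monotonicity survives the approximation, because the \<open>n\<close>-th function is first raised by
  \<open>3 / 2 ^ n\<close> and then approximated within \<open>1 / 2 ^ n\<close>: the result lies between
  \<open>\<psi> n + 2 / 2 ^ n\<close> and \<open>\<psi> n + 4 / 2 ^ n\<close>, and the next upper bound is the present lower bound.\<close>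

lemma decreasing_entire_majorants:
  fixes \<psi> :: "nat \<Rightarrow> complex \<Rightarrow> real"
  assumes cont: "\<And>n. continuous_on (sphere 0 1) (\<psi> n)"
    and dec: "\<And>n z. norm z = 1 \<Longrightarrow> \<psi> (Suc n) z \<le> \<psi> n z"
  obtains P where "\<And>n. P n holomorphic_on UNIV" "\<And>n. Im (P n 0) = 0"
    "\<And>n z. norm z = 1 \<Longrightarrow> \<psi> n z \<le> Re (P n z)"
    "\<And>n z. norm z = 1 \<Longrightarrow> Re (P n z) \<le> \<psi> n z + 4 / 2 ^ n"
    "\<And>n z. norm z = 1 \<Longrightarrow> Re (P (Suc n) z) \<le> Re (P n z)"
proof -
  have "\<exists>P. P holomorphic_on UNIV \<and> Im (P 0) = 0 \<and>
      (\<forall>z. norm z = 1 \<longrightarrow> \<bar>\<psi> n z + 3 / 2 ^ n - Re (P z)\<bar> < 1 / 2 ^ n)" for n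
    using circle_approx_Re_entire[of "\<lambda>z. \<psi> n z + 3 / 2 ^ n" "1 / 2 ^ n"]
      continuous_on_add[OF cont[of n] continuous_on_const[of _ "3 / 2 ^ n"]]
    by (metis zero_less_divide_1_iff zero_less_numeral zero_less_power)
  then obtain P where P: "\<And>n. P n holomorphic_on UNIV" "\<And>n. Im (P n 0) = 0"
    "\<And>n z. norm z = 1 \<Longrightarrow> \<bar>\<psi> n z + 3 / 2 ^ n - Re (P n z)\<bar> < 1 / 2 ^ n"
    by metis
  have lo: "\<psi> n z + 2 / 2 ^ n \<le> Re (P n z)" and hi: "Re (P n z) \<le> \<psi> n z + 4 / 2 ^ n"
    if "norm z = 1" for n z
    using P(3)[OF that, of n] by (auto simp: abs_less_iff field_simps)
  show ?thesis
  proof (rule that[OF P(1) P(2)])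
    fix n and z :: complex assume z: "norm z = 1"
    have "(0::real) \<le> 2 / 2 ^ n" by simp
    then show "\<psi> n z \<le> Re (P n z)" using lo[OF z, of n] by linarith
    show "Re (P n z) \<le> \<psi> n z + 4 / 2 ^ n" by (rule hi[OF z])
    have "(4::real) / 2 ^ Suc n = 2 / 2 ^ n" by simp
    then show "Re (P (Suc n) z) \<le> Re (P n z)"
      using hi[OF z, of "Suc n"] lo[OF z, of n] dec[OF z, of n] by linarith
  qed
qed

section \<open>Limits of outer functions\<close>

text \<open>For bounded \<open>F\<close> this says that \<open>F\<close>, carried to the unit circle, has Fourier coefficients
  \<open>0\<close> at negative indices and \<open>c\<close> at index \<open>0\<close>: it is the boundary function of a bounded
  analytic function on the disc with value \<open>c\<close> at the origin. Test functions are allowed to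
  be holomorphic on a slightly larger disc, and not only polynomial, since the moments will
  be obtained from rational functions.\<close>

definition boundary_of_analytic :: "(real \<Rightarrow> complex) \<Rightarrow> complex \<Rightarrow> bool" where
  "boundary_of_analytic F c \<longleftrightarrow> (\<forall>r R. 1 < R \<longrightarrow> r holomorphic_on ball 0 R \<longrightarrow>
    (\<integral>x. F x * r (cayley x) \<partial>cauchy_law) = c * r 0)"

text \<open>Each \<open>F\<^sub>n = exp (P n \<circ> cayley)\<close> is the boundary function of a function
  without zeros, hence so is the ratio \<open>B = F\<^sub>m / F\<^sub>n\<close>. For \<open>m \<ge> n\<close> it satisfies \<open>\<bar>B\<bar> \<le> 1\<close>, and by
  the mean value property its integral is \<open>B 0 = exp (P m 0 - P n 0)\<close>. Therefore the integral of
  \<open>\<bar>B - 1\<bar>\<^sup>2 = \<bar>B\<bar>\<^sup>2 + 1 - 2 Re B\<close> is at most \<open>2 - 2 B 0\<close>, which tends to \<open>0\<close> because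
  \<open>P n 0\<close> decreases and is bounded below. So the \<open>F\<^sub>n\<close> form a Cauchy sequence in the mean,
  although the imaginary parts of the \<open>P n\<close> on the circle are not controlled. A subsequence
  converges almost everywhere; the bounds on the modulus pass to the limit pointwise, and the mean
  values by dominated convergence. The lower bound on
  \<open>P n 0\<close> is also what keeps the value \<open>c\<close> at the origin from vanishing.\<close>

lemma outer_function_limit:
  fixes P :: "nat \<Rightarrow> complex \<Rightarrow> complex"
  assumes hol: "\<And>n. P n holomorphic_on UNIV"
    and Im0: "\<And>n. Im (P n 0) = 0"
    and dec: "\<And>n z. norm z = 1 \<Longrightarrow> Re (P (Suc n) z) \<le> Re (P n z)"
    and bdd: "\<And>n. L \<le> Re (P n 0)"
  obtains F :: "real \<Rightarrow> complex" and c :: real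
  where "F \<in> borel_measurable borel" "c > 0"
    "AE x in cauchy_law. \<forall>n. norm (F x) \<le> exp (Re (P n (cayley x)))"
    "boundary_of_analytic F c"
proof -
  have antimono: "Re (P n z) \<le> Re (P m z)" if "m \<le> n" "norm z = 1" for m n z
    using lift_Suc_antimono_le[of "\<lambda>k. Re (P k z)"] dec that by blast
  have contP: "continuous_on A (P n)" for A n
    using hol holomorphic_on_imp_continuous_on continuous_on_subset by blast
  have measP [measurable]: "(\<lambda>x. P n (cayley x)) \<in> borel_measurable borel" for n
    by (intro borel_measurable_continuous_onI continuous_on_compose2[OF contP continuous_cayley]) auto
  have P0: "P n 0 = of_real (Re (P n 0))" for n
    using Im0[of n] by (simp add: complex_eq_iff)
  have MV: "integrable cauchy_law (\<lambda>x. f (cayley x))" "(\<integral>x. f (cayley x) \<partial>cauchy_law) = f 0"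
    if "f holomorphic_on UNIV" for f
    using integral_holomorphic_cayley[of f 2] that holomorphic_on_subset by (metis one_less_numeral_iff semiring_norm(76) subset_UNIV)+
  define a where "a n = Re (P n 0)" for n
  have a_dec: "a (Suc n) \<le> a n" for n
  proof -
    have eq: "a m = (\<integral>x. Re (P m (cayley x)) \<partial>cauchy_law)" for m
      using MV[OF hol[of m]] by (simp add: a_def)
    show ?thesis
      unfolding eq by (intro integral_mono integrable_Re MV hol dec) auto
  qed
  have P0_exp: "exp (P n 0) = of_real (exp (a n))" for n
    unfolding a_def exp_of_real[symmetric] by (rule arg_cong[OF P0])
  have "decseq a"
    using a_dec by (intro decseq_SucI)
  moreover have "bdd_below (range a)"
    using bdd by (auto simp: a_def bdd_below_def)
  ultimately obtain l where l: "a \<longlonglongrightarrow> l" "\<And>n. l \<le> a n"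
    by (metis LIMSEQ_decseq_INF cINF_lower UNIV_I)
  have "\<exists>N. \<forall>n\<ge>N. a n < l + (1 / 4) ^ k" for k
    using order_tendstoD(2)[OF l(1), of "l + (1 / 4) ^ k"] by (simp add: eventually_sequentially)
  then obtain N where N: "\<And>k n. n \<ge> N k \<Longrightarrow> a n < l + (1 / 4) ^ k"
    by metis
  \<comment> \<open>A strictly increasing choice of indices with \<open>s k \<ge> N k\<close>.\<close>
  define s where "s k = k + (\<Sum>i\<le>k. N i)" for k
  have s: "k \<le> s k" "s k < s (Suc k)" "a (s k) < l + (1 / 4) ^ k" for k
  proof -
    have "N k \<le> (\<Sum>i\<le>k. N i)"
      by (rule member_le_sum) auto
    then show "a (s k) < l + (1 / 4) ^ k"
      by (intro N) (simp add: s_def)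
  qed (auto simp: s_def)
  define F' where "F' k x = exp (P (s k) (cayley x))" for k x
  have [measurable]: "F' k \<in> borel_measurable borel" for k
    unfolding F'_def by measurable
  have normF': "norm (F' k x) = exp (Re (P (s k) (cayley x)))" for k x
    by (simp add: F'_def)
  have "bounded (P 0 ` sphere 0 1)"
    by (intro compact_imp_bounded compact_continuous_image contP) auto
  then obtain K where K: "\<And>z. norm z = 1 \<Longrightarrow> norm (P 0 z) \<le> K"
    by (force simp: bounded_iff)
  define C where "C = exp K"
  have F'_le: "norm (F' k x) \<le> C" for k x
    unfolding normF' C_def
    using antimono[of 0 "s k" "cayley x"] K[of "cayley x"] complex_Re_le_cmod[of "P 0 (cayley x)"]
    by simp
  have C: "C > 0"
    by (simp add: C_def)
  have diff: "(\<integral>\<^sup>+x. norm (F' (Suc k) x - F' k x) \<partial>cauchy_law) \<le> ennreal (C * 3 * (1 / 2) ^ k)" for k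
  proof -
    define B where "B z = exp (P (s (Suc k)) z - P (s k) z)" for z
    have holB: "B holomorphic_on UNIV"
      unfolding B_def by (intro holomorphic_intros hol)
    have normB: "norm (B (cayley x)) \<le> 1" for x
      using antimono[of "s k" "s (Suc k)" "cayley x"] s(2)[of k] by (simp add: B_def)
    have "B 0 = of_real (exp (a (s (Suc k)) - a (s k)))"
      unfolding B_def by (subst (1 2) P0) (simp add: a_def exp_of_real[symmetric])
    then have ReB: "(\<integral>x. Re (B (cayley x)) \<partial>cauchy_law) = exp (a (s (Suc k)) - a (s k))"
      using MV[OF holB] by simp
    have intB: "integrable cauchy_law (\<lambda>x. Re (B (cayley x)))"
      using MV[OF holB] by simp
    have sq: "(norm (b - 1))\<^sup>2 \<le> 2 - 2 * Re b" if "norm b \<le> 1" for b :: complex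
    proof -
      have "(norm (b - 1))\<^sup>2 = (norm b)\<^sup>2 + 1 - 2 * Re b"
        by (simp add: cmod_power2) (simp add: power2_eq_square algebra_simps)
      moreover have "(norm b)\<^sup>2 \<le> 1"
        using that by (simp add: power_le_one)
      ultimately show ?thesis by linarith
    qed
    \<comment> \<open>This takes the place of the Cauchy-Schwarz inequality; the weights match
      \<open>a (s k) - l < (1 / 4) ^ k\<close>.\<close>
    have amgm: "t \<le> (1 / 2) ^ k + 2 ^ k * t\<^sup>2" for t :: real
    proof (cases "t \<le> (1 / 2) ^ k")
      case False
      then have "1 \<le> 2 ^ k * t"
        by (simp add: field_simps)
      moreover have "0 \<le> t"
        using False by (smt (verit) zero_le_divide_1_iff zero_le_power)
      ultimately have "t * 1 \<le> t * (2 ^ k * t)"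
        by (intro mult_left_mono) auto
      then show ?thesis
        by (simp add: power2_eq_square algebra_simps)
          (smt (verit) zero_le_divide_1_iff zero_le_power)
    next
      case True
      then show ?thesis
        by (smt (verit) mult_nonneg_nonneg zero_le_power zero_le_power2)
    qed
    have "norm (F' (Suc k) x - F' k x) \<le> C * ((1 / 2) ^ k + 2 ^ k * (2 - 2 * Re (B (cayley x))))" for x
    proof -
      have "F' (Suc k) x - F' k x = F' k x * (B (cayley x) - 1)"
        by (simp add: F'_def B_def exp_diff field_simps)
      then have "norm (F' (Suc k) x - F' k x) = norm (F' k x) * norm (B (cayley x) - 1)"
        by (simp add: norm_mult)
      also have "\<dots> \<le> C * norm (B (cayley x) - 1)"
        by (intro mult_right_mono F'_le) auto
      also have "\<dots> \<le> C * ((1 / 2) ^ k + 2 ^ k * (norm (B (cayley x) - 1))\<^sup>2)"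
        using C by (intro mult_left_mono amgm) auto
      also have "\<dots> \<le> C * ((1 / 2) ^ k + 2 ^ k * (2 - 2 * Re (B (cayley x))))"
        using C by (intro mult_left_mono add_left_mono sq normB) auto
      finally show ?thesis .
    qed
    then have "(\<integral>\<^sup>+x. norm (F' (Suc k) x - F' k x) \<partial>cauchy_law)
        \<le> (\<integral>\<^sup>+x. ennreal (C * ((1 / 2) ^ k + 2 ^ k * (2 - 2 * Re (B (cayley x))))) \<partial>cauchy_law)"
      by (intro nn_integral_mono ennreal_leI) auto
    also have "\<dots> = ennreal (\<integral>x. C * ((1 / 2) ^ k + 2 ^ k * (2 - 2 * Re (B (cayley x)))) \<partial>cauchy_law)"
    proof (rule nn_integral_eq_integral)
      show "integrable cauchy_law (\<lambda>x. C * ((1 / 2) ^ k + 2 ^ k * (2 - 2 * Re (B (cayley x)))))"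
        using intB by auto
      have "0 \<le> 2 - 2 * Re (B (cayley x))" for x
        using normB[of x] complex_Re_le_cmod[of "B (cayley x)"] by linarith
      then show "AE x in cauchy_law. 0 \<le> C * ((1 / 2) ^ k + 2 ^ k * (2 - 2 * Re (B (cayley x))))"
        using C by (intro AE_I2 mult_nonneg_nonneg add_nonneg_nonneg) auto
    qed
    also have "(\<integral>x. C * ((1 / 2) ^ k + 2 ^ k * (2 - 2 * Re (B (cayley x)))) \<partial>cauchy_law)
        = C * ((1 / 2) ^ k + 2 ^ k * (2 - 2 * exp (a (s (Suc k)) - a (s k))))"
      using intB cauchy_law.prob_space by (simp add: ReB)
    also have "\<dots> \<le> C * ((1 / 2) ^ k + 2 ^ k * (2 * (1 / 4) ^ k))"
    proof -
      have "2 - 2 * exp (a (s (Suc k)) - a (s k)) \<le> 2 * (1 / 4) ^ k"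
        using exp_ge_add_one_self[of "a (s (Suc k)) - a (s k)"] s(3)[of k] l(2)[of "s (Suc k)"]
        by linarith
      then show ?thesis
        using C by (intro mult_left_mono add_left_mono) auto
    qed
    also have "C * ((1 / 2) ^ k + 2 ^ k * (2 * (1 / 4) ^ k)) = C * 3 * (1 / 2) ^ k"
    proof -
      have "(2::real) ^ k * (1 / 4) ^ k = (1 / 2) ^ k"
        by (simp flip: power_mult_distrib)
      then show ?thesis by (simp add: algebra_simps)
    qed
    finally show ?thesis
      by (simp add: ennreal_leI)
  qed
  have conv: "AE x in cauchy_law. convergent (\<lambda>k. F' k x)"
  proof -
    have "(\<integral>\<^sup>+x. (\<Sum>k. ennreal (norm (F' (Suc k) x - F' k x))) \<partial>cauchy_law)
        = (\<Sum>k. \<integral>\<^sup>+x. norm (F' (Suc k) x - F' k x) \<partial>cauchy_law)"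
      by (intro nn_integral_suminf) auto
    also have "\<dots> \<le> (\<Sum>k. ennreal (C * 3 * (1 / 2) ^ k))"
      by (intro suminf_le diff) auto
    also have "\<dots> < \<infinity>"
      using C summable_geometric[of "1 / 2 :: real"]
      by (subst suminf_ennreal2) auto
    finally have "AE x in cauchy_law. (\<Sum>k. ennreal (norm (F' (Suc k) x - F' k x))) \<noteq> \<infinity>"
      by (intro nn_integral_PInf_AE) auto
    then show ?thesis
    proof eventually_elim
      case (elim x)
      then have "summable (\<lambda>k. norm (F' (Suc k) x - F' k x))"
        by (intro summable_suminf_not_top) auto
      then have "summable (\<lambda>k. F' (Suc k) x - F' k x)"
        by (rule summable_norm_cancel)
      then show ?case
        using sum_lessThan_telescope[of "\<lambda>k. F' k x"]
        by (simp add: summable_iff_convergent convergent_diff_const_right_iff)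
    qed
  qed
  define F where "F x = lim (\<lambda>k. F' k x)" for x
  have [measurable]: "F \<in> borel_measurable borel"
    unfolding F_def by measurable
  have lim: "AE x in cauchy_law. (\<lambda>k. F' k x) \<longlonglongrightarrow> F x"
    using conv by eventually_elim (simp add: F_def convergent_LIMSEQ_iff)
  show ?thesis
  proof (rule that[of F "exp l"])
    show "AE x in cauchy_law. \<forall>n. norm (F x) \<le> exp (Re (P n (cayley x)))"
      using lim
    proof (eventually_elim, intro allI)
      fix x n assume "(\<lambda>k. F' k x) \<longlonglongrightarrow> F x"
      then have "(\<lambda>k. norm (F' k x)) \<longlonglongrightarrow> norm (F x)"
        by (rule tendsto_norm)
      moreover have "eventually (\<lambda>k. norm (F' k x) \<le> exp (Re (P n (cayley x)))) sequentially"
        using eventually_ge_at_top[of n]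
      proof eventually_elim
        case (elim k)
        then show ?case
          using s(1)[of k] unfolding normF' by (simp add: antimono)
      qed
      ultimately show "norm (F x) \<le> exp (Re (P n (cayley x)))"
        by (rule tendsto_upperbound) auto
    qed
  next
    show "boundary_of_analytic F (exp l)"
      unfolding boundary_of_analytic_def
    proof (intro allI impI)
      fix r :: "complex \<Rightarrow> complex" and R :: real
      assume R: "R > 1" and r: "r holomorphic_on ball 0 R"
      have contr: "continuous_on (ball 0 R) r"
        by (rule holomorphic_on_imp_continuous_on[OF r])
      have [measurable]: "(\<lambda>x. r (cayley x)) \<in> borel_measurable borel"
        by (intro borel_measurable_continuous_onI continuous_on_compose2[OF contr continuous_cayley])
          (use R in auto)
      have "bounded (r ` sphere 0 1)"
        by (intro compact_imp_bounded compact_continuous_image continuous_on_subset[OF contr])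
          (use R in auto)
      then obtain D where D: "\<And>z. norm z = 1 \<Longrightarrow> norm (r z) \<le> D"
        by (force simp: bounded_iff)
      have "(\<lambda>k. \<integral>x. F' k x * r (cayley x) \<partial>cauchy_law)
          \<longlonglongrightarrow> (\<integral>x. F x * r (cayley x) \<partial>cauchy_law)"
      proof (rule integral_dominated_convergence[where w = "\<lambda>_. C * D"])
        show "AE x in cauchy_law. (\<lambda>k. F' k x * r (cayley x)) \<longlonglongrightarrow> F x * r (cayley x)"
          using lim by eventually_elim (intro tendsto_intros)
        show "AE x in cauchy_law. norm (F' k x * r (cayley x)) \<le> C * D" for k
          unfolding norm_mult using C by (intro AE_I2 mult_mono F'_le D) auto
      qed auto
      moreover have "(\<integral>x. F' k x * r (cayley x) \<partial>cauchy_law) = complex_of_real (exp (a (s k))) * r 0" for k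
      proof -
        have "(\<lambda>z. exp (P (s k) z) * r z) holomorphic_on ball 0 R"
          by (intro holomorphic_intros r holomorphic_on_subset[OF hol]) auto
        from integral_holomorphic_cayley(2)[OF this R] show ?thesis
          unfolding F'_def P0_exp[symmetric] .
    qed
    moreover have "(\<lambda>k. complex_of_real (exp (a (s k))) * r 0) \<longlonglongrightarrow> complex_of_real (exp l) * r 0"
    proof -
      have "strict_mono s"
        using s(2) by (simp add: strict_mono_Suc_iff)
      then have "(\<lambda>k. a (s k)) \<longlonglongrightarrow> l"
        using LIMSEQ_subseq_LIMSEQ[OF l(1)] by (simp add: o_def)
      then show ?thesis
        by (intro tendsto_intros)
    qed
    ultimately show "(\<integral>x. F x * r (cayley x) \<partial>cauchy_law) = complex_of_real (exp l) * r 0"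
      using LIMSEQ_unique by auto
    qed
  qed auto
qed

section \<open>An analytic boundary function dominated by the density\<close>

text \<open>A number \<open>t \<ge> 0\<close> is at most the number of naturals below it; so \<open>- ln (g x)\<close> is at most the
  number of the sets \<open>E k = {x. g x < exp (- k)}\<close> that contain \<open>x\<close>. Enlarge \<open>E k\<close> to an open set
  \<open>U k\<close>, keeping the sum of the probabilities finite. The function \<open>- (\<Sum>k. indicator (U k))\<close> is
  then at most \<open>ln g\<close>, it is integrable, and it is the limit of a decreasing sequence of continuous
  functions on the circle, to which the limit of outer functions applies. Such a sequence does not exist
  for \<open>ln g\<close> itself, which need not be semicontinuous; this is why the open sets are used.\<close>

lemma outer_function_minorant:
  fixes g :: "real \<Rightarrow> real"
  assumes [measurable]: "g \<in> borel_measurable borel"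
    and nonneg: "\<And>x. 0 \<le> g x"
    and fin: "(\<Sum>k. emeasure cauchy_law {x. g x < exp (- real k)}) < \<infinity>"
  obtains F :: "real \<Rightarrow> complex" and c :: real
  where "F \<in> borel_measurable borel" "c > 0" "\<And>x. norm (F x) \<le> g x"
    "boundary_of_analytic F c"
proof -
  define E where "E k = {x. g x < exp (- real k)}" for k
  have [measurable]: "E k \<in> sets borel" for k
    unfolding E_def by measurable
  have "\<exists>U. open U \<and> E k \<subseteq> U \<and> emeasure cauchy_law U \<le> emeasure cauchy_law (E k) + ennreal ((1 / 2) ^ k)" for k
  proof -
    have "emeasure cauchy_law (E k) < emeasure cauchy_law (E k) + ennreal ((1 / 2) ^ k)"
      by (simp add: cauchy_law.emeasure_eq_measure ennreal_less_iff flip: ennreal_plus)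
    moreover have "emeasure cauchy_law (E k) = (INF U \<in> {U. E k \<subseteq> U \<and> open U}. emeasure cauchy_law U)"
      by (rule outer_regular) (auto simp: cauchy_law.emeasure_eq_measure)
    ultimately show ?thesis
      by (metis (no_types, lifting) INF_less_iff mem_Collect_eq order_less_imp_le)
  qed
  then obtain U where U: "\<And>k. open (U k)" "\<And>k. E k \<subseteq> U k"
    "\<And>k. emeasure cauchy_law (U k) \<le> emeasure cauchy_law (E k) + ennreal ((1 / 2) ^ k)"
    by metis
  have [measurable]: "U k \<in> sets borel" for k
    using U(1) by auto
  have "(\<Sum>k. emeasure cauchy_law (U k)) \<le> (\<Sum>k. emeasure cauchy_law (E k) + ennreal ((1 / 2) ^ k))"
    by (intro suminf_le U) auto
  also have "\<dots> = (\<Sum>k. emeasure cauchy_law (E k)) + (\<Sum>k. ennreal ((1 / 2) ^ k))"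
    by (rule suminf_add[symmetric]) auto
  also have "\<dots> < \<infinity>"
    using fin summable_geometric[of "1 / 2 :: real"]
    by (subst suminf_ennreal2) (auto simp: E_def)
  finally have sumU: "summable (\<lambda>k. measure cauchy_law (U k))"
    by (intro summable_suminf_not_top) (auto simp: cauchy_law.emeasure_eq_measure)
  \<comment> \<open>On the circle, this is the image of the complement of \<open>U k\<close> together with
    \<open>-1\<close>. The point \<open>-1\<close> is put into \<open>K k\<close> because the distance to the empty set is \<open>0\<close>, which would be wrong for \<open>U k = UNIV\<close>.\<close>
  define K where "K k = - {z. z \<in> - {-1} \<and> Re (\<i> * (1 - z) / (1 + z)) \<in> U k}" for k
  have "open ((- {-1}) \<inter> (\<lambda>z. Re (\<i> * (1 - z) / (1 + z))) -` U k)" for k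
    using U(1) by (intro continuous_open_preimage continuous_intros) (auto simp: add_eq_0_iff)
  then have closedK: "closed (K k)" for k
    unfolding K_def closed_def by (simp add: vimage_def Int_def)
  have K_ne: "K k \<noteq> {}" for k
    by (auto simp: K_def)
  have K_iff: "cayley x \<in> K k \<longleftrightarrow> x \<notin> U k" for k x
    by (simp add: K_def inverse_cayley)
  define \<psi> where "\<psi> n z = - (\<Sum>k<n. min 1 (real n * infdist z (K k)))" for n z
  have cont\<psi>: "continuous_on A (\<psi> n)" for A n
    unfolding \<psi>_def by (intro continuous_intros)
  have dec: "\<psi> (Suc n) z \<le> \<psi> n z" for n z
  proof -
    have "(\<Sum>k<n. min 1 (real n * infdist z (K k))) \<le> (\<Sum>k<n. min 1 (real (Suc n) * infdist z (K k)))"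
      by (intro sum_mono min.mono mult_right_mono) (auto simp: infdist_nonneg)
    also have "\<dots> \<le> (\<Sum>k<Suc n. min 1 (real (Suc n) * infdist z (K k)))"
      by (simp add: infdist_nonneg)
    finally show ?thesis
      by (simp add: \<psi>_def)
  qed
  have \<psi>_ge: "- (\<Sum>k<n. indicator (U k) x) \<le> \<psi> n (cayley x)" for n x
    unfolding \<psi>_def
    by (intro le_imp_neg_le sum_mono) (auto simp: indicator_def K_iff)
  obtain P where P: "\<And>n. P n holomorphic_on UNIV" "\<And>n. Im (P n 0) = 0"
    "\<And>n z. norm z = 1 \<Longrightarrow> \<psi> n z \<le> Re (P n z)"
    "\<And>n z. norm z = 1 \<Longrightarrow> Re (P n z) \<le> \<psi> n z + 4 / 2 ^ n"
    "\<And>n z. norm z = 1 \<Longrightarrow> Re (P (Suc n) z) \<le> Re (P n z)"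
    using decreasing_entire_majorants[of \<psi>] cont\<psi> dec by metis
  have bdd: "- (\<Sum>k. measure cauchy_law (U k)) \<le> Re (P n 0)" for n
  proof -
    have hol: "P n holomorphic_on ball 0 2"
      using P(1) holomorphic_on_subset by blast
    have "- (\<Sum>k. measure cauchy_law (U k)) \<le> - (\<Sum>k<n. measure cauchy_law (U k))"
      using sumU by (intro le_imp_neg_le sum_le_suminf) auto
    also have "\<dots> = (\<integral>x. - (\<Sum>k<n. indicator (U k) x) \<partial>cauchy_law)"
      by (simp add: cauchy_law.emeasure_eq_measure)
    also have "\<dots> \<le> (\<integral>x. Re (P n (cayley x)) \<partial>cauchy_law)"
    proof (intro integral_mono)
      show "integrable cauchy_law (\<lambda>x. Re (P n (cayley x)))"
        using integral_holomorphic_cayley(1)[OF hol] by simp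
      show "- (\<Sum>k<n. indicator (U k) x) \<le> Re (P n (cayley x))" for x
        using \<psi>_ge[where n = n and x = x] P(3)[of "cayley x" n] by simp
    qed (simp add: cauchy_law.emeasure_eq_measure)
    also have "\<dots> = Re (P n 0)"
      using integral_holomorphic_cayley[OF hol] by simp
    finally show ?thesis .
  qed
  obtain F and c :: real where F [measurable]: "F \<in> borel_measurable borel" and c: "c > 0"
    and F_le: "AE x in cauchy_law. \<forall>n. norm (F x) \<le> exp (Re (P n (cayley x)))"
    and MV: "boundary_of_analytic F c"
    by (rule outer_function_limit[of P, OF P(1,2) _ bdd]) (rule P(5), assumption, rule that)
  have bound: "norm (F x) \<le> exp (- real N)"
    if F_le: "\<And>n. norm (F x) \<le> exp (Re (P n (cayley x)))" and xU: "\<And>k. k < N \<Longrightarrow> x \<in> U k" for x N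
  proof -
    have "\<forall>\<^sub>F n in sequentially. \<forall>k\<in>{..<N}. 1 \<le> real n * infdist (cayley x) (K k)"
    proof (intro eventually_ball_finite ballI)
      fix k assume "k \<in> {..<N}"
      then have "cayley x \<notin> K k"
        by (simp add: K_iff xU)
      then have pos: "infdist (cayley x) (K k) > 0"
        by (intro infdist_pos_not_in_closed closedK K_ne)
      obtain m :: nat where m: "1 / infdist (cayley x) (K k) < real m"
        using reals_Archimedean2 by blast
      show "\<forall>\<^sub>F n in sequentially. 1 \<le> real n * infdist (cayley x) (K k)"
        using eventually_ge_at_top[of m]
      proof eventually_elim
        case (elim n)
        then have "1 / infdist (cayley x) (K k) \<le> real n"
          using m by linarith
        then show ?case
          using pos by (simp add: field_simps)
      qed
    qed simp
    then have "\<forall>\<^sub>F n in sequentially. norm (F x) \<le> exp (- real N + 4 * (1 / 2) ^ n)"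
      using eventually_ge_at_top[of N]
    proof eventually_elim
      case (elim n)
      have "real N = (\<Sum>k<N. 1)"
        by simp
      also have "\<dots> \<le> (\<Sum>k<N. min 1 (real n * infdist (cayley x) (K k)))"
        using elim(1) by (intro sum_mono) auto
      also have "\<dots> \<le> (\<Sum>k<n. min 1 (real n * infdist (cayley x) (K k)))"
        using elim(2) by (intro sum_mono2) (auto simp: infdist_nonneg)
      finally have "\<psi> n (cayley x) \<le> - real N"
        by (simp add: \<psi>_def)
      then have "Re (P n (cayley x)) \<le> - real N + 4 * (1 / 2) ^ n"
        using P(4)[of "cayley x" n] by (simp add: power_divide)
      then show ?case
        using F_le[of n] by (meson exp_le_cancel_iff order_trans)
    qed
    moreover have "(\<lambda>n. exp (- real N + 4 * (1 / 2) ^ n)) \<longlonglongrightarrow> exp (- real N + 4 * 0)"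
      by (intro tendsto_intros LIMSEQ_realpow_zero) auto
    ultimately have "norm (F x) \<le> exp (- real N + 4 * 0)"
      by (intro tendsto_lowerbound) auto
    then show ?thesis
      by simp
  qed
  have AE_le: "AE x in cauchy_law. norm (F x) \<le> g x"
    using F_le
  proof eventually_elim
    case (elim x)
    show ?case
    proof (cases "g x = 0")
      case True
      then have "x \<in> U k" for k
        using U(2)[of k] by (auto simp: E_def)
      then have le: "norm (F x) \<le> exp (- real N)" for N
        using elim by (intro bound) auto
      have "(\<lambda>N. exp (- real N)) \<longlonglongrightarrow> 0"
        by real_asymp
      then have "norm (F x) \<le> 0"
        by (rule tendsto_lowerbound) (auto simp: le)
      then show ?thesis
        using True by simp
    next
      case False
      then have pos: "g x > 0"
        using nonneg[of x] by simp
      define N where "N = nat \<lceil>- ln (g x)\<rceil>"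
      have "x \<in> U k" if "k < N" for k
      proof -
        have "real k < - ln (g x)"
          using that unfolding N_def by linarith
        then have "exp (ln (g x)) < exp (- real k)"
          by simp
        then have "g x < exp (- real k)"
          using pos by simp
        then show ?thesis
          using U(2)[of k] by (auto simp: E_def)
      qed
      then have "norm (F x) \<le> exp (- real N)"
        using elim by (intro bound) auto
      also have "exp (- real N) \<le> exp (ln (g x))"
        unfolding exp_le_cancel_iff N_def by linarith
      also have "\<dots> = g x"
        using pos by simp
      finally show ?thesis .
    qed
  qed
  \<comment> \<open>Redefinition on a null set turns the almost sure bound into a pointwise one.\<close>
  define F0 where "F0 x = (if norm (F x) \<le> g x then F x else 0)" for x
  have [measurable]: "F0 \<in> borel_measurable borel"
    unfolding F0_def by measurable
  show ?thesis
  proof (rule that[of F0 c])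
    show "norm (F0 x) \<le> g x" for x
      using nonneg by (simp add: F0_def)
    show "boundary_of_analytic F0 c"
      unfolding boundary_of_analytic_def
    proof (intro allI impI)
      fix r :: "complex \<Rightarrow> complex" and R :: real
      assume R: "R > 1" and r: "r holomorphic_on ball 0 R"
      have [measurable]: "(\<lambda>x. r (cayley x)) \<in> borel_measurable cauchy_law"
        using integral_holomorphic_cayley(1)[OF r R] by (rule borel_measurable_integrable)
      have "(\<integral>x. F0 x * r (cayley x) \<partial>cauchy_law) = (\<integral>x. F x * r (cayley x) \<partial>cauchy_law)"
        by (intro integral_cong_AE) (use AE_le in \<open>auto simp: F0_def\<close>)
      then show "(\<integral>x. F0 x * r (cayley x) \<partial>cauchy_law) = complex_of_real c * r 0"
        using MV R r by (simp add: boundary_of_analytic_def)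
    qed
  qed (use c in auto)
qed

text \<open>Conversely, the number of naturals below \<open>t \<ge> 0\<close> is at most \<open>1 + t\<close>, so that the sum of the
  probabilities of the level sets is controlled by the positive part of the Krein integral.\<close>

lemma krein_integral_level_sets:
  fixes g :: "real \<Rightarrow> real"
  assumes [measurable]: "g \<in> borel_measurable borel"
    and nonneg: "\<And>x. 0 \<le> g x"
    and krein: "krein_integral g < \<infinity>"
  shows "(\<Sum>k. emeasure cauchy_law {x. g x < exp (- real k)}) < \<infinity>"
proof -
  define p where "p = (\<integral>\<^sup>+ x. e2ennreal (krein_integrand g x) \<partial>lborel)"
  have "p \<noteq> \<infinity>"
    using krein by (auto simp: krein_integral_def p_def)
  have [measurable]: "krein_integrand g \<in> borel_measurable borel"
    unfolding krein_integrand_def[abs_def] by measurable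
  define d :: "real \<Rightarrow> real" where "d x = 1 / (pi * (1 + x\<^sup>2))" for x
  have [measurable]: "d \<in> borel_measurable borel"
    unfolding d_def by measurable
  let ?E = "\<lambda>k::nat. {x. g x < exp (- real k)}"
  have le: "ennreal (d x) * (\<Sum>k. indicator (?E k) x) \<le> ennreal (d x) + e2ennreal (krein_integrand g x)" for x
  proof (cases "g x = 0")
    case True
    then show ?thesis
      by (simp add: krein_integrand_def)
  next
    case False
    then have pos: "g x > 0"
      using nonneg[of x] by simp
    define t where "t = - ln (g x)"
    define N where "N = nat \<lceil>t\<rceil>"
    have in_iff: "x \<in> ?E k \<longleftrightarrow> real k < t" for k
      unfolding t_def using pos by (simp add: ln_less_cancel_iff[symmetric] less_minus_iff)
    have "(\<Sum>k. indicator (?E k) x :: ennreal) = (\<Sum>k<N. indicator (?E k) x)"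
    proof (rule suminf_finite)
      fix k assume "k \<notin> {..<N}"
      then have "t \<le> real k"
        unfolding N_def by (simp; linarith)
      then show "indicator (?E k) x = (0 :: ennreal)"
        using in_iff[of k] by (simp add: indicator_def)
    qed simp
    also have "\<dots> \<le> (\<Sum>k<N. 1)"
      by (intro sum_mono) (auto simp: indicator_def)
    also have "\<dots> = ennreal (real N)"
      by (simp add: ennreal_of_nat_eq_real_of_nat)
    also have "\<dots> \<le> ennreal (1 + max 0 t)"
      by (intro ennreal_leI) (unfold N_def, linarith)
    finally have "ennreal (d x) * (\<Sum>k. indicator (?E k) x) \<le> ennreal (d x) * ennreal (1 + max 0 t)"
      by (intro mult_left_mono) auto
    also have "\<dots> = ennreal (d x) + ennreal (d x * max 0 t)"
    proof -
      have "0 \<le> d x"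
        by (simp add: d_def)
      then show ?thesis
        by (simp add: ennreal_mult[symmetric] distrib_left ennreal_plus[symmetric] del: ennreal_plus)
    qed
    also have "\<dots> \<le> ennreal (d x) + e2ennreal (krein_integrand g x)"
    proof (intro add_left_mono)
      have "d x * max 0 t \<le> max 0 (t / (1 + x\<^sup>2))"
      proof -
        have "1 \<le> pi"
          using pi_gt3 by simp
        moreover have "1 + x\<^sup>2 > 0"
          by (smt (verit) zero_le_power2)
        ultimately have "1 * (1 + x\<^sup>2) \<le> pi * (1 + x\<^sup>2)"
          by (intro mult_right_mono) auto
        then have "d x \<le> 1 / (1 + x\<^sup>2)"
          unfolding d_def using \<open>1 + x\<^sup>2 > 0\<close> by (intro divide_left_mono) auto
        then have "d x * max 0 t \<le> 1 / (1 + x\<^sup>2) * max 0 t"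
          by (intro mult_right_mono) auto
        also have "\<dots> = max 0 (t / (1 + x\<^sup>2))"
          using \<open>1 + x\<^sup>2 > 0\<close> by (auto simp: max_def zero_le_divide_iff)
        finally show ?thesis .
      qed
      moreover have "e2ennreal (krein_integrand g x) = ennreal (max 0 (t / (1 + x\<^sup>2)))"
        using False by (simp add: krein_integrand_def t_def e2ennreal_ereal ennreal_max_0)
      ultimately show "ennreal (d x * max 0 t) \<le> e2ennreal (krein_integrand g x)"
        by (metis ennreal_leI)
    qed
    finally show ?thesis .
  qed
  have "(\<Sum>k. emeasure cauchy_law (?E k)) = (\<Sum>k. \<integral>\<^sup>+x. indicator (?E k) x \<partial>cauchy_law)"
    by simp
  also have "\<dots> = (\<integral>\<^sup>+x. (\<Sum>k. indicator (?E k) x) \<partial>cauchy_law)"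
    by (rule nn_integral_suminf[symmetric]) measurable
  also have "\<dots> = (\<integral>\<^sup>+x. ennreal (d x) * (\<Sum>k. indicator (?E k) x) \<partial>lborel)"
    unfolding cauchy_law_def d_def by (rule nn_integral_density) auto
  also have "\<dots> \<le> (\<integral>\<^sup>+x. ennreal (d x) + e2ennreal (krein_integrand g x) \<partial>lborel)"
    by (intro nn_integral_mono le)
  also have "\<dots> = (\<integral>\<^sup>+x. ennreal (d x) \<partial>lborel) + p"
    unfolding p_def by (rule nn_integral_add) auto
  also have "(\<integral>\<^sup>+x. ennreal (d x) \<partial>lborel) = 1"
    using cauchy_law.emeasure_space_1 by (simp add: cauchy_law_def emeasure_density d_def)
  also have "1 + p < \<infinity>"
    using \<open>p \<noteq> \<infinity>\<close> by (simp add: top.not_eq_extremum)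
  finally show ?thesis .
qed

section \<open>Vanishing moments\<close>

text \<open>Up to the factor \<open>pi\<close>, the integral is the Cauchy mean of \<open>F x\<close> times \<open>x ^ j (1 + x\<^sup>2)\<close>.
  The latter is the rational function \<open>(\<i> (1 - z) / (1 + z)) ^ j * 4 z / (1 + z)\<^sup>2\<close> of
  \<open>z = cayley x\<close>, which vanishes at the origin; the factor \<open>z\<close> comes from \<open>1 + x\<^sup>2\<close>. Its pole at
  \<open>-1\<close> is moved out of the closed disc by writing \<open>1 + \<rho> z\<close> with \<open>\<rho> < 1\<close> in place of \<open>1 + z\<close>. As
  \<open>\<rho>\<close> tends to \<open>1\<close>, the integrand stays dominated, since \<open>\<bar>1 + z\<bar> \<le> 2 \<bar>1 + \<rho> z\<bar>\<close> on the circle.\<close>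

lemma moments_vanish:
  fixes F :: "real \<Rightarrow> complex" and g :: "real \<Rightarrow> real"
  assumes [measurable]: "F \<in> borel_measurable borel"
    and F_le: "\<And>x. norm (F x) \<le> g x"
    and MV: "boundary_of_analytic F c"
    and int: "integrable lborel (\<lambda>x. g x * \<bar>x\<bar> ^ j)"
  shows "(\<integral>x. F x * of_real (x ^ j) \<partial>lborel) = 0"
proof -
  define \<rho> where "\<rho> n = 1 - 1 / real (n + 2)" for n
  have \<rho>: "0 < \<rho> n" "\<rho> n < 1" for n
    by (simp_all add: \<rho>_def field_simps)
  define r :: "nat \<Rightarrow> complex \<Rightarrow> complex" where
    "r n z = (\<i> * (1 - z) / (1 + \<rho> n * z)) ^ j * (4 * z / (1 + \<rho> n * z)\<^sup>2)" for n and z :: complex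
  define f where "f n x = (1 / (pi * (1 + x\<^sup>2))) *\<^sub>R (F x * r n (cayley x))" for n x
  have pos: "1 + x\<^sup>2 > 0" for x :: real
    by (smt (verit) zero_le_power2)
  have [measurable]: "(\<lambda>x. r n (cayley x)) \<in> borel_measurable borel" for n
    unfolding r_def by measurable
  have [measurable]: "f n \<in> borel_measurable borel" for n
    unfolding f_def by measurable
  have zero: "(\<integral>x. f n x \<partial>lborel) = 0" for n
  proof -
    have "1 + \<rho> n * z \<noteq> 0" if "z \<in> ball 0 (1 / \<rho> n)" for z :: complex
    proof
      assume "1 + \<rho> n * z = 0"
      then have "\<rho> n * z = - 1"
        by (simp add: add_eq_0_iff)
      then have "norm (\<rho> n * z) = 1"
        by simp
      then have "\<rho> n * norm z = 1"
        using \<rho>[of n] by (simp add: norm_mult)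
      then show False
        using that \<rho>[of n] by (simp add: field_simps)
    qed
    then have "r n holomorphic_on ball 0 (1 / \<rho> n)"
      unfolding r_def by (intro holomorphic_intros) auto
    moreover have "1 < 1 / \<rho> n"
      using \<rho>[of n] by simp
    ultimately have "(\<integral>x. F x * r n (cayley x) \<partial>cauchy_law) = c * r n 0"
      using MV by (auto simp: boundary_of_analytic_def)
    also have "r n 0 = 0"
      by (simp add: r_def)
    finally have "(\<integral>x. F x * r n (cayley x) \<partial>cauchy_law) = 0"
      by simp
    then show ?thesis
      unfolding f_def by (subst (asm) integral_cauchy_law) auto
  qed
  have "(\<lambda>n. \<integral>x. f n x \<partial>lborel) \<longlonglongrightarrow> (\<integral>x. (1 / pi) *\<^sub>R (F x * of_real (x ^ j)) \<partial>lborel)"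
  proof (rule integral_dominated_convergence[where w = "\<lambda>x. (4 * 2 ^ j / pi) * (g x * \<bar>x\<bar> ^ j)"])
    show "integrable lborel (\<lambda>x. (4 * 2 ^ j / pi) * (g x * \<bar>x\<bar> ^ j))"
      using int by (rule integrable_mult_right)
    show "AE x in lborel. (\<lambda>n. f n x) \<longlonglongrightarrow> (1 / pi) *\<^sub>R (F x * of_real (x ^ j))"
    proof (rule AE_I2)
      fix x :: real
      have "\<rho> \<longlonglongrightarrow> 1"
        unfolding \<rho>_def by real_asymp
      then have "(\<lambda>n. r n (cayley x)) \<longlonglongrightarrow>
          (\<i> * (1 - cayley x) / (1 + of_real 1 * cayley x)) ^ j * (4 * cayley x / (1 + of_real 1 * cayley x)\<^sup>2)"
        unfolding r_def by (intro tendsto_intros) auto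
      then have "(\<lambda>n. f n x) \<longlonglongrightarrow>
          (1 / (pi * (1 + x\<^sup>2))) *\<^sub>R (F x * (of_real x ^ j * of_real (1 + x\<^sup>2)))"
        unfolding f_def by (intro tendsto_intros) (simp add: inverse_cayley one_plus_square_cayley)
      also have "(1 / (pi * (1 + x\<^sup>2))) *\<^sub>R (F x * (of_real x ^ j * of_real (1 + x\<^sup>2)))
          = (1 / pi) *\<^sub>R (F x * of_real (x ^ j))"
      proof -
        have "(1 / (pi * s)) *\<^sub>R (F x * (of_real x ^ j * of_real s)) = (1 / pi) *\<^sub>R (F x * of_real (x ^ j))"
          if "s \<noteq> 0" for s :: real
          using that by (simp add: scaleR_conv_of_real)
        then show ?thesis
          using pos[of x] by (metis less_irrefl)
      qed
      finally show "(\<lambda>n. f n x) \<longlonglongrightarrow> (1 / pi) *\<^sub>R (F x * of_real (x ^ j))" .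
    qed
    show "AE x in lborel. norm (f n x) \<le> (4 * 2 ^ j / pi) * (g x * \<bar>x\<bar> ^ j)" for n
    proof (rule AE_I2)
      fix x :: real
      define w where "w = cayley x"
      have w: "norm w = 1" "1 + w \<noteq> 0"
        by (simp_all add: w_def)
      have den: "norm (1 + w) \<le> 2 * norm (1 + \<rho> n * w)"
      proof -
        have "1 + w = (1 + \<rho> n * w) + (1 - \<rho> n) * w"
          by (simp add: algebra_simps)
        then have "norm (1 + w) \<le> norm (1 + \<rho> n * w) + norm ((1 - \<rho> n) * w)"
          by (metis norm_triangle_ineq)
        also have "norm ((1 - \<rho> n) * w) = 1 - \<rho> n"
          unfolding norm_mult norm_of_real using \<rho>[of n] w by simp
        also have "1 - \<rho> n \<le> norm (1 + \<rho> n * w)"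
        proof -
          have "norm (1 :: complex) - norm (- (\<rho> n * w)) \<le> norm (1 - (- (\<rho> n * w)))"
            by (rule norm_triangle_ineq2)
          then show ?thesis
            using \<rho>[of n] w by (simp add: norm_mult)
        qed
        finally show ?thesis by simp
      qed
      have pos1: "norm (1 + w) > 0"
        using w by simp
      have pos\<rho>: "norm (1 + \<rho> n * w) > 0"
        using den pos1 by linarith
      have cmp: "1 / norm (1 + \<rho> n * w) \<le> 2 / norm (1 + w)"
        using den pos1 pos\<rho> by (simp add: field_simps)
      have "norm (\<i> * (1 - w) / (1 + \<rho> n * w)) = norm (1 - w) * (1 / norm (1 + \<rho> n * w))"
        by (simp add: norm_divide norm_mult)
      also have "\<dots> \<le> norm (1 - w) * (2 / norm (1 + w))"
        by (intro mult_left_mono cmp) auto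
      also have "\<dots> = 2 * norm (\<i> * (1 - w) / (1 + w))"
        by (simp add: norm_divide norm_mult)
      also have "\<dots> = 2 * \<bar>x\<bar>"
        unfolding w_def inverse_cayley by simp
      finally have b1: "norm (\<i> * (1 - w) / (1 + \<rho> n * w)) \<le> 2 * \<bar>x\<bar>" .
      have "norm (4 * w / (1 + \<rho> n * w)\<^sup>2) = 4 * (1 / norm (1 + \<rho> n * w))\<^sup>2"
        using w by (simp add: norm_divide norm_mult norm_power power_divide)
      also have "\<dots> \<le> 4 * (2 / norm (1 + w))\<^sup>2"
        by (intro mult_left_mono power_mono cmp) auto
      also have "\<dots> = 4 * norm (4 * w / (1 + w)\<^sup>2)"
        using w by (simp add: norm_divide norm_mult norm_power power_divide)
      also have "\<dots> = 4 * (1 + x\<^sup>2)"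
        unfolding w_def one_plus_square_cayley norm_of_real using pos[of x] by simp
      finally have b2: "norm (4 * w / (1 + \<rho> n * w)\<^sup>2) \<le> 4 * (1 + x\<^sup>2)" .
      have "norm (r n w) \<le> (2 * \<bar>x\<bar>) ^ j * (4 * (1 + x\<^sup>2))"
        unfolding r_def norm_mult[of "_ ^ j"] norm_power[of _ j]
        by (intro mult_mono power_mono b1 b2) auto
      then have "norm (F x) * norm (r n w) \<le> g x * ((2 * \<bar>x\<bar>) ^ j * (4 * (1 + x\<^sup>2)))"
        using F_le[of x] by (intro mult_mono) (auto intro: order_trans[OF norm_ge_zero])
      then have "norm (f n x) \<le> 1 / (pi * (1 + x\<^sup>2)) * (g x * ((2 * \<bar>x\<bar>) ^ j * (4 * (1 + x\<^sup>2))))"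
        unfolding f_def norm_scaleR norm_mult w_def using pos[of x]
        by (simp add: divide_right_mono)
      also have "\<dots> = (4 * 2 ^ j / pi) * (g x * \<bar>x\<bar> ^ j)"
      proof -
        have "1 / (pi * s) * (g x * ((2 * \<bar>x\<bar>) ^ j * (4 * s))) = (4 * 2 ^ j / pi) * (g x * \<bar>x\<bar> ^ j)"
          if "s > 0" for s
          using that by (simp add: power_mult_distrib)
        then show ?thesis
          using pos[of x] by blast
      qed
      finally show "norm (f n x) \<le> (4 * 2 ^ j / pi) * (g x * \<bar>x\<bar> ^ j)" .
    qed
  qed auto
  then have "(\<integral>x. (1 / pi) *\<^sub>R (F x * of_real (x ^ j)) \<partial>lborel) = 0"
    unfolding zero by (simp add: LIMSEQ_const_iff)
  then show ?thesis
    by simp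
qed

section \<open>Symmetric perturbations of a density\<close>

lemma density_lborel_reflect:
  fixes g :: "real \<Rightarrow> real"
  assumes [measurable]: "g \<in> borel_measurable borel"
  shows "distr (density lborel (\<lambda>x. ennreal (g x))) borel (\<lambda>x. - x)
    = density lborel (\<lambda>x. ennreal (g (- x)))"
proof -
  have "density (distr lborel borel (\<lambda>x::real. - x)) (\<lambda>x. ennreal (g (- x)))
      = distr (density lborel (\<lambda>x. ennreal (g (- (- x))))) borel (\<lambda>x. - x)"
    by (rule density_distr) auto
  then show ?thesis
    by (simp add: lborel_distr_uminus)
qed

lemma symmetric_density_reflect:
  fixes g \<phi> :: "real \<Rightarrow> real"
  assumes [measurable]: "g \<in> borel_measurable borel" "\<phi> \<in> borel_measurable borel"
    and nonneg: "\<And>x. 0 \<le> g x"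
    and sym: "symmetric_distribution (density lborel (\<lambda>x. ennreal (g x)))"
    and int: "integrable lborel (\<lambda>x. g x * \<phi> x)"
  shows "integrable lborel (\<lambda>x. g (- x) * \<phi> x)"
    and "(\<integral>x. g (- x) * \<phi> x \<partial>lborel) = (\<integral>x. g x * \<phi> x \<partial>lborel)"
proof -
  have eq: "density lborel (\<lambda>x. ennreal (g (- x))) = density lborel (\<lambda>x. ennreal (g x))"
    using sym by (simp add: symmetric_distribution_def density_lborel_reflect)
  have "integrable (density lborel (\<lambda>x. ennreal (g x))) \<phi>"
    using int nonneg by (subst integrable_density) auto
  then have "integrable (density lborel (\<lambda>x. ennreal (g (- x)))) \<phi>"
    by (simp only: eq)
  then show "integrable lborel (\<lambda>x. g (- x) * \<phi> x)"
    using nonneg by (subst (asm) integrable_density) auto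
  have "(\<integral>x. g (- x) * \<phi> x \<partial>lborel) = integral\<^sup>L (density lborel (\<lambda>x. ennreal (g (- x)))) \<phi>"
    using nonneg by (subst integral_density) auto
  also have "\<dots> = (\<integral>x. g x * \<phi> x \<partial>lborel)"
    unfolding eq using nonneg by (subst integral_density) auto
  finally show "(\<integral>x. g (- x) * \<phi> x \<partial>lborel) = (\<integral>x. g x * \<phi> x \<partial>lborel)" .
qed

definition symmetrization :: "(real \<Rightarrow> real) \<Rightarrow> real \<Rightarrow> real" where
  "symmetrization q x = (q x + q (- x)) / 2"

text \<open>Symmetrizing the density does not affect integrals against \<open>g\<close>, even though \<open>g\<close>
  itself is even only up to a null set. The perturbation contributes through its even part.\<close>

lemma integral_symmetrization_perturbed:
  fixes g f \<phi> :: "real \<Rightarrow> real"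
  assumes [measurable]: "g \<in> borel_measurable borel" "f \<in> borel_measurable borel"
      "\<phi> \<in> borel_measurable borel"
    and f_le: "\<And>x. \<bar>f x\<bar> \<le> g x"
    and sym: "symmetric_distribution (density lborel (\<lambda>x. ennreal (g x)))"
    and int: "integrable lborel (\<lambda>x. g x * \<phi> x)"
  shows "integrable lborel (\<lambda>x. symmetrization (\<lambda>y. g y + f y) x * \<phi> x)"
    and "(\<integral>x. symmetrization (\<lambda>y. g y + f y) x * \<phi> x \<partial>lborel) = (\<integral>x. g x * \<phi> x \<partial>lborel)
      + ((\<integral>x. f x * \<phi> x \<partial>lborel) + (\<integral>x. f x * \<phi> (- x) \<partial>lborel)) / 2"
proof -
  have nonneg: "0 \<le> g x" for x
    using f_le[of x] by linarith
  note refl = symmetric_density_reflect[OF _ _ nonneg sym int]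
  have int_f: "integrable lborel (\<lambda>x. f x * \<phi> x)"
    by (rule Bochner_Integration.integrable_bound[OF int])
      (use f_le nonneg in \<open>auto simp: abs_mult intro!: mult_right_mono AE_I2\<close>)
  have int_f': "integrable lborel (\<lambda>x. f (- x) * \<phi> x)"
    by (rule Bochner_Integration.integrable_bound[OF refl(1)])
      (use f_le nonneg in \<open>auto simp: abs_mult intro!: mult_right_mono AE_I2\<close>)
  have eq: "symmetrization (\<lambda>y. g y + f y) x * \<phi> x
      = (g x * \<phi> x + g (- x) * \<phi> x + (f x * \<phi> x + f (- x) * \<phi> x)) / 2" for x
    by (simp add: symmetrization_def algebra_simps)
  show "integrable lborel (\<lambda>x. symmetrization (\<lambda>y. g y + f y) x * \<phi> x)"
    unfolding eq using int refl(1) int_f int_f' by auto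
  have "(\<integral>x. f (- x) * \<phi> x \<partial>lborel) = (\<integral>x. f x * \<phi> (- x) \<partial>lborel)"
    using lborel_integral_real_affine[of "-1" "\<lambda>x. f (- x) * \<phi> x" 0] by simp
  then show "(\<integral>x. symmetrization (\<lambda>y. g y + f y) x * \<phi> x \<partial>lborel) = (\<integral>x. g x * \<phi> x \<partial>lborel)
      + ((\<integral>x. f x * \<phi> x \<partial>lborel) + (\<integral>x. f x * \<phi> (- x) \<partial>lborel)) / 2"
    unfolding eq using int refl int_f int_f' by simp
qed

section \<open>Indeterminacy\<close>

theorem lemma3:
  fixes M :: "'a measure" and Y :: "'a \<Rightarrow> real" and g :: "real \<Rightarrow> real"
  assumes "prob_space M"
    and "Y \<in> borel_measurable M"
    and "\<And>x. 0 \<le> g x"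
    and "distributed M lborel Y (\<lambda>x. ennreal (g x))"
    and "symmetric_distribution (distr M borel Y)"
    and "finite_moments M Y"
    and "krein_integral g < \<infinity>"
  shows "\<exists>G' :: real measure. real_distribution G' \<and> symmetric_distribution G' \<and>
    G' \<noteq> distr M borel Y \<and>
    finite_moments G' (\<lambda>x. x) \<and>
    (\<forall>k\<ge>1. moment G' (\<lambda>x. x) k = moment M Y k)"
proof -
  interpret prob_space M by fact
  note [measurable] = assms(2)
  note g_nonneg = assms(3) and Y = assms(4)
  have [measurable]: "g \<in> borel_measurable borel"
    using distributed_real_measurable[OF _ Y] g_nonneg by simp
  have "distr M lborel Y = distr M borel Y"
    by (rule distr_cong) auto
  then have G: "distr M borel Y = density lborel (\<lambda>x. ennreal (g x))"
    using distributed_distr_eq_density[OF Y] by simp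
  have sym: "symmetric_distribution (density lborel (\<lambda>x. ennreal (g x)))"
    using assms(5) by (simp add: G)
  have int_Y: "integrable lborel (\<lambda>x. g x * \<phi> x) \<longleftrightarrow> integrable M (\<lambda>\<omega>. \<phi> (Y \<omega>))"
    and integral_Y: "(\<integral>x. g x * \<phi> x \<partial>lborel) = (\<integral>\<omega>. \<phi> (Y \<omega>) \<partial>M)"
    if "\<phi> \<in> borel_measurable borel" for \<phi> :: "real \<Rightarrow> real"
    using distributed_integrable[OF Y, of \<phi>] distributed_integral[OF Y, of \<phi>] that g_nonneg by auto
  have int_abs: "integrable lborel (\<lambda>x. g x * \<bar>x\<bar> ^ k)" for k
  proof (cases "k = 0")
    case True
    then show ?thesis
      by (subst int_Y) auto
  next
    case False
    then show ?thesis
      using assms(6) by (subst int_Y) (auto simp: finite_moments_def)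
  qed
  have int_pow: "integrable lborel (\<lambda>x. g x * x ^ k)" for k
    by (rule Bochner_Integration.integrable_bound[OF int_abs[of k]])
      (auto simp: abs_mult power_abs)
  obtain F and c :: real where F [measurable]: "F \<in> borel_measurable borel" and "c > 0"
    and F_le: "\<And>x. norm (F x) \<le> g x" and MV: "boundary_of_analytic F c"
    by (rule outer_function_minorant[of g])
      (use g_nonneg krein_integral_level_sets[of g] assms(7) in auto)
  define f where "f x = Re (F x)" for x
  have [measurable]: "f \<in> borel_measurable borel"
    unfolding f_def by measurable
  have f_le: "\<bar>f x\<bar> \<le> g x" for x
    using abs_Re_le_cmod[of "F x"] F_le[of x] by (simp add: f_def)
  have f_moment: "(\<integral>x. f x * x ^ k \<partial>lborel) = 0" for k
  proof -
    have "integrable lborel (\<lambda>x. F x * of_real (x ^ k))"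
      by (rule Bochner_Integration.integrable_bound[OF int_abs[of k]])
        (use F_le g_nonneg in \<open>auto simp: norm_mult norm_power abs_mult intro!: mult_right_mono AE_I2\<close>)
    from integral_Re[OF this] show ?thesis
      using moments_vanish[OF F F_le MV int_abs] by (simp add: f_def)
  qed
  \<comment> \<open>Integration of \<open>\<phi>\<close> will tell the two distributions apart: up to the factor \<open>pi\<close>, the
    integral of \<open>f \<phi>\<close> is the value \<open>c > 0\<close> of the analytic function at the origin.\<close>
  define \<phi> :: "real \<Rightarrow> real" where "\<phi> x = 1 / (1 + x\<^sup>2)" for x
  have [measurable]: "\<phi> \<in> borel_measurable borel"
    unfolding \<phi>_def by measurable
  have \<phi>_le: "0 \<le> \<phi> x" "\<phi> x \<le> 1" for x
    by (auto simp: \<phi>_def divide_le_eq_1 intro: add_pos_nonneg)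
  have int_g\<phi>: "integrable lborel (\<lambda>x. g x * \<phi> x)"
    by (rule Bochner_Integration.integrable_bound[OF int_abs[of 0]])
      (use \<phi>_le g_nonneg in \<open>auto simp: abs_mult intro!: mult_left_le AE_I2\<close>)
  have f_\<phi>: "(\<integral>x. f x * \<phi> x \<partial>lborel) = pi * c"
  proof -
    have "integrable lborel (\<lambda>x. F x * of_real (\<phi> x))"
      by (rule Bochner_Integration.integrable_bound[OF int_g\<phi>])
        (use F_le \<phi>_le g_nonneg in \<open>auto simp: norm_mult abs_mult intro!: mult_right_mono AE_I2\<close>)
    from integral_Re[OF this] have "(\<integral>x. f x * \<phi> x \<partial>lborel) = Re (\<integral>x. F x * of_real (\<phi> x) \<partial>lborel)"
      by (simp add: f_def)
    also have "(\<integral>x. F x * of_real (\<phi> x) \<partial>lborel) = (\<integral>x. pi *\<^sub>R ((1 / (pi * (1 + x\<^sup>2))) *\<^sub>R F x) \<partial>lborel)"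
      by (intro Bochner_Integration.integral_cong refl) (simp add: \<phi>_def scaleR_conv_of_real)
    also have "\<dots> = pi *\<^sub>R (\<integral>x. F x \<partial>cauchy_law)"
      by (subst integral_scaleR_right) (auto simp: integral_cauchy_law)
    also have "(\<integral>x. F x \<partial>cauchy_law) = c"
      using MV[unfolded boundary_of_analytic_def, rule_format, of 2 "\<lambda>_. 1"] by simp
    finally show ?thesis
      by simp
  qed
  define q where "q = symmetrization (\<lambda>x. g x + f x)"
  have [measurable]: "q \<in> borel_measurable borel"
    unfolding q_def symmetrization_def[abs_def] by measurable
  have q_nonneg: "0 \<le> q x" for x
    using f_le[of x] f_le[of "- x"] by (simp add: q_def symmetrization_def)
  have q_int: "integrable lborel (\<lambda>x. q x * \<eta> x)"
    and q_integral: "(\<integral>x. q x * \<eta> x \<partial>lborel) = (\<integral>x. g x * \<eta> x \<partial>lborel)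
      + ((\<integral>x. f x * \<eta> x \<partial>lborel) + (\<integral>x. f x * \<eta> (- x) \<partial>lborel)) / 2"
    if "\<eta> \<in> borel_measurable borel" "integrable lborel (\<lambda>x. g x * \<eta> x)" for \<eta>
    unfolding q_def using that f_le sym by (auto intro: integral_symmetrization_perturbed)
  have q_moment: "(\<integral>x. q x * x ^ k \<partial>lborel) = (\<integral>x. g x * x ^ k \<partial>lborel)" for k
  proof -
    have "(\<integral>x. f x * (- x) ^ k \<partial>lborel) = (\<integral>x. (- 1) ^ k * (f x * x ^ k) \<partial>lborel)"
      by (intro Bochner_Integration.integral_cong refl) (subst power_minus, simp)
    also have "\<dots> = 0"
      by (subst integral_mult_right_zero) (simp add: f_moment)
    finally show ?thesis
      using q_integral[OF _ int_pow[of k]] by (simp add: f_moment)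
  qed
  define G' where "G' = density lborel (\<lambda>x. ennreal (q x))"
  have integral_G': "integral\<^sup>L G' \<eta> = (\<integral>x. q x * \<eta> x \<partial>lborel)"
    and int_G': "integrable G' \<eta> \<longleftrightarrow> integrable lborel (\<lambda>x. q x * \<eta> x)"
    if "\<eta> \<in> borel_measurable borel" for \<eta> :: "real \<Rightarrow> real"
    unfolding G'_def using that q_nonneg by (auto simp: integral_density integrable_density)
  have "prob_space G'"
  proof
    have "integrable lborel q" "(\<integral>x. q x \<partial>lborel) = 1"
      using q_int[OF _ int_pow[of 0]] q_moment[of 0] integral_Y[of "\<lambda>_. 1"] prob_space by simp_all
    then have "(\<integral>\<^sup>+x. ennreal (q x) \<partial>lborel) = 1"
      using q_nonneg by (subst nn_integral_eq_integral) auto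
    then show "emeasure G' (space G') = 1"
      by (simp add: G'_def emeasure_density)
  qed
  then have "real_distribution G'"
    by (simp add: real_distribution_def real_distribution_axioms_def G'_def)
  moreover have "symmetric_distribution G'"
  proof -
    have "q (- x) = q x" for x
      by (simp add: q_def symmetrization_def add.commute)
    then show ?thesis
      by (simp add: symmetric_distribution_def G'_def density_lborel_reflect)
  qed
  moreover have "G' \<noteq> distr M borel Y"
  proof
    assume "G' = distr M borel Y"
    then have "(\<integral>x. q x * \<phi> x \<partial>lborel) = (\<integral>x. g x * \<phi> x \<partial>lborel)"
      using integral_G'[of \<phi>] integral_Y[of \<phi>] by (simp add: integral_distr)
    moreover have "(\<integral>x. q x * \<phi> x \<partial>lborel) = (\<integral>x. g x * \<phi> x \<partial>lborel) + pi * c"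
      using q_integral[OF _ int_g\<phi>] f_\<phi> by (simp add: \<phi>_def)
    ultimately show False
      using \<open>c > 0\<close> by simp
  qed
  moreover have "finite_moments G' (\<lambda>x. x)"
    unfolding finite_moments_def by (auto simp: int_G' intro!: q_int int_abs)
  moreover have "moment G' (\<lambda>x. x) k = moment M Y k" for k
    unfolding moment_def by (simp add: integral_G' q_moment integral_Y)
  ultimately show ?thesis
    by blast
qed

end
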